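(* The sets of non-negative and of sums of squares ternary octics invariant under $D_3$ are equal, i.e., $\Sigma_{3,8}^{D_3}=\mathcal{P}_{3,8}^{D_3}$.
   Context: $D_3$ is the group acting on $\mathbb{R}^3$ by coordinate permutations combined with an even number of sign changes. $\mathcal{P}_{3,8}^{D_3}$ is the cone of $D_3$-invariant real forms of degree 8 in three variables that are non-negative on $\mathbb{R}^3$, and $\Sigma_{3,8}^{D_3}$ is the cone of those $D_3$-invariant forms of degree 8 in three variables that are sums of squares of real forms. *)

theory Defs
  imports "HOL-Analysis.Analysis" "HOL-Library.Poly_Mapping"
begin

text \<open>
  A real polynomial in three variables is a finitely supported map from exponent vectors to
  coefficients; the multiplication of \<^typ>\<open>(3 \<Rightarrow>\<^sub>0 nat) \<Rightarrow>\<^sub>0 real\<close> is the convolution product, so this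
  type is the polynomial ring itself (not the ring of polynomial functions).
\<close>

type_synonym ternary_poly = "(3 \<Rightarrow>\<^sub>0 nat) \<Rightarrow>\<^sub>0 real"

definition eval_poly :: "ternary_poly \<Rightarrow> real ^ 3 \<Rightarrow> real" where
  "eval_poly f x = (\<Sum>m\<in>Poly_Mapping.keys f.
     Poly_Mapping.lookup f m * (\<Prod>i\<in>UNIV. (x $ i) ^ Poly_Mapping.lookup m i))"

text \<open>The zero polynomial is a form of every degree, so that the forms of degree \<open>d\<close> are a vector space.\<close>

definition is_form :: "nat \<Rightarrow> ternary_poly \<Rightarrow> bool" where
  "is_form d f \<longleftrightarrow>
     (\<forall>m\<in>Poly_Mapping.keys f. (\<Sum>i\<in>UNIV. Poly_Mapping.lookup m i) = d)"

definition D3 :: "(real ^ 3 \<Rightarrow> real ^ 3) set" where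
  "D3 = {(\<lambda>x. \<chi> i. s i * x $ p i) | (p :: 3 \<Rightarrow> 3) (s :: 3 \<Rightarrow> real).
           bij p \<and> (\<forall>i. s i = 1 \<or> s i = - 1) \<and> even (card {i. s i = - 1})}"

definition D3_invariant :: "ternary_poly \<Rightarrow> bool" where
  "D3_invariant f \<longleftrightarrow> (\<forall>g\<in>D3. \<forall>x. eval_poly f (g x) = eval_poly f x)"

definition sum_of_squares_of_forms :: "ternary_poly \<Rightarrow> bool" where
  "sum_of_squares_of_forms f \<longleftrightarrow>
     (\<exists>(k :: nat) (q :: nat \<Rightarrow> ternary_poly).
        (\<forall>j<k. \<exists>e. is_form e (q j)) \<and> f = (\<Sum>j<k. (q j)\<^sup>2))"

definition nonneg_D3_forms :: "nat \<Rightarrow> ternary_poly set" where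
  "nonneg_D3_forms d = {f. is_form d f \<and> D3_invariant f \<and> (\<forall>x. 0 \<le> eval_poly f x)}"

definition sos_D3_forms :: "nat \<Rightarrow> ternary_poly set" where
  "sos_D3_forms d = {f. is_form d f \<and> D3_invariant f \<and> sum_of_squares_of_forms f}"

end

theory Submission
  imports Defs "HOL-Real_Asymp.Real_Asymp"
begin

text \<open>
  A \<open>D\<^sub>3\<close>-invariant octic is even, hence a symmetric quartic
  \<open>g = \<alpha> s\<^sub>1\<^sup>4 + \<beta> s\<^sub>1\<^sup>2 s\<^sub>2 + \<gamma> s\<^sub>2\<^sup>2 + \<delta> s\<^sub>1 s\<^sub>3\<close> in the elementary symmetric functions of
  \<open>(a, b, c) = (x\<^sup>2, y\<^sup>2, z\<^sup>2)\<close>, non-negative on the orthant. Let \<open>h(t) = g(1, 1, t)\<close>. Subtract the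
  largest multiple of \<open>s\<^sub>1 s\<^sub>3\<close>, which is a sum of squares, that keeps \<open>h \<ge> 0\<close> on \<open>t \<ge> 0\<close>; then \<open>h\<close>
  acquires a zero \<open>t\<^sub>0\<close>. If \<open>t\<^sub>0 = 1\<close>, then \<open>h = (t-1)\<^sup>2 (p t\<^sup>2 + q t + r)\<close> with a quadratic factor that
  is non-negative for \<open>t \<ge> 0\<close>, and \<open>g\<close> is a sum of terms \<open>(a-b)\<^sup>2 (P (a+b) + Q c)\<^sup>2\<close> and
  \<open>a b (a-b)\<^sup>2\<close>. Otherwise \<open>t\<^sub>0\<close> is a double zero, and this forces \<open>g\<close> to be a combination of
  \<open>\<Sum> (a-b)\<^sup>2 (a+b-(1+t\<^sub>0) c)\<^sup>2\<close> and the square of a combination of \<open>s\<^sub>1\<^sup>2\<close> and \<open>s\<^sub>2\<close>. Both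
  coefficients turn out to be non-negative.
\<close>

section \<open>Evaluation of polynomials\<close>

lemma prod_3: "(\<Prod>i\<in>UNIV. f i) = f 1 * f 2 * f (3::3)"
  for f :: "3 \<Rightarrow> 'a::comm_monoid_mult"
  unfolding UNIV_3 by (simp add: mult.assoc)

definition monom_eval :: "(3 \<Rightarrow>\<^sub>0 nat) \<Rightarrow> real ^ 3 \<Rightarrow> real" where
  "monom_eval m x = (\<Prod>i\<in>UNIV. (x $ i) ^ Poly_Mapping.lookup m i)"

lemma monom_eval_add: "monom_eval (m + n) x = monom_eval m x * monom_eval n x"
  by (simp add: monom_eval_def lookup_add power_add prod.distrib)

text \<open>Additivity needs this: the keys of a sum may shrink by cancellation, so the summands are
  compared over one common finite index set.\<close>

lemma eval_poly_superset:
  assumes "finite S" "Poly_Mapping.keys f \<subseteq> S"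
  shows "eval_poly f x = (\<Sum>m\<in>S. Poly_Mapping.lookup f m * monom_eval m x)"
  unfolding eval_poly_def monom_eval_def
  by (rule sum.mono_neutral_left[OF assms]) (auto simp: in_keys_iff)

lemma eval_poly_add: "eval_poly (f + g) x = eval_poly f x + eval_poly g x"
proof -
  let ?S = "Poly_Mapping.keys f \<union> Poly_Mapping.keys g"
  show ?thesis
    using eval_poly_superset[of ?S f x] eval_poly_superset[of ?S g x]
      eval_poly_superset[of ?S "f + g" x] keys_add[of f g]
    by (simp add: lookup_add algebra_simps sum.distrib)
qed

lemma eval_poly_zero [simp]: "eval_poly 0 x = 0"
  by (simp add: eval_poly_def)

lemma eval_poly_single: "eval_poly (Poly_Mapping.single m c) x = c * monom_eval m x"
  using eval_poly_superset[of "{m}" "Poly_Mapping.single m c" x] by (simp split: if_splits)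

lemma eval_poly_uminus: "eval_poly (- f) x = - eval_poly f x"
  using eval_poly_add[of f "- f" x] by simp

lemma eval_poly_diff: "eval_poly (f - g) x = eval_poly f x - eval_poly g x"
  using eval_poly_add[of f "- g" x] by (simp add: eval_poly_uminus)

lemma eval_poly_sum: "eval_poly (\<Sum>j\<in>J. f j) x = (\<Sum>j\<in>J. eval_poly (f j) x)"
  by (induction J rule: infinite_finite_induct) (simp_all add: eval_poly_add)

lemma poly_mapping_eq_sum_single:
  "f = (\<Sum>m\<in>Poly_Mapping.keys f. Poly_Mapping.single m (Poly_Mapping.lookup f m))"
  by (rule poly_mapping_eqI) (auto simp: lookup_sum lookup_single when_def in_keys_iff)

lemma eval_poly_mult: "eval_poly (f * g) x = eval_poly f x * eval_poly g x"
proof -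
  have "f * g = (\<Sum>m\<in>Poly_Mapping.keys f. \<Sum>n\<in>Poly_Mapping.keys g.
      Poly_Mapping.single (m + n) (Poly_Mapping.lookup f m * Poly_Mapping.lookup g n))"
    by (subst poly_mapping_eq_sum_single[of f], subst poly_mapping_eq_sum_single[of g])
      (simp add: sum_product mult_single)
  then have "eval_poly (f * g) x = (\<Sum>m\<in>Poly_Mapping.keys f. \<Sum>n\<in>Poly_Mapping.keys g.
      (Poly_Mapping.lookup f m * Poly_Mapping.lookup g n) * (monom_eval m x * monom_eval n x))"
    by (simp add: eval_poly_sum eval_poly_single monom_eval_add)
  also have "\<dots> = eval_poly f x * eval_poly g x"
    unfolding eval_poly_def monom_eval_def[symmetric] sum_product
    by (intro sum.cong) (auto simp: mult_ac)
  finally show ?thesis .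
qed

lemma eval_poly_power2: "eval_poly (f\<^sup>2) x = (eval_poly f x)\<^sup>2"
  by (simp add: power2_eq_square eval_poly_mult)

text \<open>Uniqueness of base-\<open>N\<close> digits by reduction mod \<open>N\<close>. The top
  digit \<open>c\<close> may be arbitrary.\<close>

lemma base_expansion_inj:
  fixes N :: nat
  assumes "a < N" "b < N" "a' < N" "b' < N"
    and "a + N * (b + N * c) = a' + N * (b' + N * c')"
  shows "a = a' \<and> b = b' \<and> c = c'"
proof -
  have a: "a = a'"
    using assms(1,3) mod_mult_self2[of a N "b + N * c"] mod_mult_self2[of a' N "b' + N * c'"]
      assms(5) by (metis mod_less)
  then have eq: "b + N * c = b' + N * c'" using assms by simp
  have "b = b'"
    using assms(2,4) mod_mult_self2[of b N c] mod_mult_self2[of b' N c'] eq by (metis mod_less)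
  then show ?thesis using a eq assms by simp
qed

text \<open>Kronecker substitution \<open>(t, t^N, t^(N^2))\<close> with \<open>N\<close> larger than all exponents keeps distinct
  monomials distinct and so reduces the claim to polynomials in one variable.\<close>

lemma eval_poly_inject_zero:
  assumes "\<And>x. eval_poly f x = 0"
  shows "f = 0"
proof (rule ccontr)
  assume "f \<noteq> 0"
  define K where "K = Poly_Mapping.keys f"
  have K: "finite K" "K \<noteq> {}" using \<open>f \<noteq> 0\<close> by (auto simp: K_def poly_mapping_eq_iff in_keys_iff fun_eq_iff)
  define N where "N = Suc (Max (\<Union>m\<in>K. range (Poly_Mapping.lookup m)))"
  have bound: "Poly_Mapping.lookup m i < N" if "m \<in> K" for m i
    unfolding N_def less_Suc_eq_le by (rule Max_ge) (use K that in auto)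
  define e where "e = (\<lambda>m::3 \<Rightarrow>\<^sub>0 nat. Poly_Mapping.lookup m 1
    + N * (Poly_Mapping.lookup m 2 + N * Poly_Mapping.lookup m 3))"
  have inj: "inj_on e K"
  proof (rule inj_onI)
    fix m n assume mn: "m \<in> K" "n \<in> K" "e m = e n"
    have "\<forall>i. Poly_Mapping.lookup m i = Poly_Mapping.lookup n i"
      using base_expansion_inj[OF bound bound bound bound mn(3)[unfolded e_def]] mn
      by (simp add: forall_3)
    then show "m = n" by (intro poly_mapping_eqI) simp
  qed
  define p where "p = (\<Sum>m\<in>K. monom (Poly_Mapping.lookup f m) (e m))"
  have "poly p t = 0" for t
  proof -
    let ?x = "vector [t, t ^ N, t ^ (N * N)] :: real ^ 3"
    have "monom_eval m ?x = t ^ e m" for m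
      by (simp only: monom_eval_def e_def prod_3 vector_3 power_add power_mult distrib_left mult.assoc)
    then have "poly p t = eval_poly f ?x"
      by (simp add: p_def poly_sum poly_monom eval_poly_def monom_eval_def[symmetric] K_def)
    then show ?thesis using assms by simp
  qed
  then have "p = 0" by (simp add: poly_eq_poly_eq_iff[symmetric] fun_eq_iff)
  obtain m where m: "m \<in> K" using K by blast
  \<comment> \<open>By injectivity of \<open>e\<close>, no other monomial of \<open>f\<close>
    contributes to this coefficient.\<close>
  have "coeff p (e m) = (\<Sum>n\<in>K. if n = m then Poly_Mapping.lookup f n else 0)"
    unfolding p_def coeff_sum by (intro sum.cong) (use inj m in \<open>auto simp: inj_on_def\<close>)
  also have "\<dots> = Poly_Mapping.lookup f m" using K m by simp
  finally show False using \<open>p = 0\<close> m by (simp add: K_def in_keys_iff)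
qed

text \<open>The bridge from identities of real functions to identities in the polynomial ring, so
  that the final decomposition can be checked pointwise.\<close>

lemma eval_poly_inject:
  assumes "\<And>x. eval_poly f x = eval_poly g x"
  shows "f = g"
  using eval_poly_inject_zero[of "f - g"] assms by (simp add: eval_poly_diff)

section \<open>Forms and sums of squares\<close>

lemma is_form_add: "is_form d f \<Longrightarrow> is_form d g \<Longrightarrow> is_form d (f + g)"
  using keys_add[of f g] unfolding is_form_def by blast

lemma is_form_diff: "is_form d f \<Longrightarrow> is_form d g \<Longrightarrow> is_form d (f - g)"
proof -
  have "Poly_Mapping.keys (f - g) \<subseteq> Poly_Mapping.keys f \<union> Poly_Mapping.keys g"
    by (auto simp: in_keys_iff lookup_minus)
  then show "is_form d f \<Longrightarrow> is_form d g \<Longrightarrow> is_form d (f - g)"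
    unfolding is_form_def by blast
qed

lemma is_form_mult: "is_form d f \<Longrightarrow> is_form e g \<Longrightarrow> is_form (d + e) (f * g)"
  using keys_mult[of f g] unfolding is_form_def by (force simp: lookup_add sum.distrib)

lemma is_form_power2: "is_form d f \<Longrightarrow> is_form (d + d) (f\<^sup>2)"
  unfolding power2_eq_square by (rule is_form_mult)

definition const_poly :: "real \<Rightarrow> ternary_poly" where
  "const_poly c = Poly_Mapping.single 0 c"

definition var :: "3 \<Rightarrow> ternary_poly" where
  "var i = Poly_Mapping.single (Poly_Mapping.single i 1) 1"

lemma eval_const_poly: "eval_poly (const_poly c) x = c"
  by (simp add: const_poly_def eval_poly_single monom_eval_def)

lemma eval_var: "eval_poly (var i) x = x $ i"
proof -
  have "(\<Prod>j\<in>UNIV. (x $ j) ^ Poly_Mapping.lookup (Poly_Mapping.single i (1::nat)) j)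
      = (\<Prod>j\<in>UNIV. if j = i then x $ j else 1)"
    by (intro prod.cong) (auto simp: lookup_single when_def)
  then show ?thesis by (simp add: var_def eval_poly_single monom_eval_def)
qed

lemma is_form_const_poly: "is_form 0 (const_poly c)"
  by (simp add: is_form_def const_poly_def)

lemma is_form_var: "is_form 1 (var i)"
proof -
  have "(\<Sum>j\<in>UNIV. Poly_Mapping.lookup (Poly_Mapping.single i (1::nat)) j)
      = (\<Sum>j\<in>UNIV. if j = i then 1 else 0)"
    by (intro sum.cong) (auto simp: lookup_single when_def)
  then show ?thesis by (simp add: is_form_def var_def)
qed

lemma sum_of_squares_of_forms_add:
  assumes "sum_of_squares_of_forms f" "sum_of_squares_of_forms g"
  shows "sum_of_squares_of_forms (f + g)"
proof -
  obtain k :: nat and p where p: "\<And>j. j < k \<Longrightarrow> \<exists>e. is_form e (p j)" "f = (\<Sum>j<k. (p j)\<^sup>2)"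
    using assms(1) unfolding sum_of_squares_of_forms_def by blast
  obtain l :: nat and q where q: "\<And>j. j < l \<Longrightarrow> \<exists>e. is_form e (q j)" "g = (\<Sum>j<l. (q j)\<^sup>2)"
    using assms(2) unfolding sum_of_squares_of_forms_def by blast
  let ?r = "\<lambda>j. if j < k then p j else q (j - k)"
  have "(\<Sum>j<k+n. (?r j)\<^sup>2) = f + (\<Sum>j<n. (q j)\<^sup>2)" for n
    by (induction n) (simp_all add: p(2) add_ac)
  then have "(\<Sum>j<k+l. (?r j)\<^sup>2) = f + g" by (simp add: q(2))
  moreover have "\<exists>e. is_form e (?r j)" if "j < k + l" for j
    using p(1)[of j] q(1)[of "j - k"] that by auto
  ultimately show ?thesis
    unfolding sum_of_squares_of_forms_def by (intro exI[of _ "k + l"] exI[of _ ?r]) auto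
qed

lemma sum_of_squares_of_forms_power2: "is_form e q \<Longrightarrow> sum_of_squares_of_forms (q\<^sup>2)"
  unfolding sum_of_squares_of_forms_def by (rule exI[of _ 1], rule exI[of _ "\<lambda>_. q"]) auto

lemma sum_of_squares_of_forms_nonneg:
  "sum_of_squares_of_forms f \<Longrightarrow> 0 \<le> eval_poly f x"
proof -
  assume "sum_of_squares_of_forms f"
  then obtain k :: nat and q where "f = (\<Sum>j<k. (q j)\<^sup>2)"
    unfolding sum_of_squares_of_forms_def by blast
  then have "eval_poly f x = (\<Sum>j<k. (eval_poly (q j) x)\<^sup>2)"
    by (simp only: eval_poly_sum eval_poly_power2)
  then show ?thesis by (simp only: sum_nonneg zero_le_power2)
qed

section \<open>Forms as triangular sums over exponents\<close>

definition expo :: "nat \<Rightarrow> nat \<Rightarrow> nat \<Rightarrow> 3 \<Rightarrow>\<^sub>0 nat" where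
  "expo i j k = Poly_Mapping.single 1 i + Poly_Mapping.single 2 j + Poly_Mapping.single 3 k"

lemma lookup_expo [simp]:
  "Poly_Mapping.lookup (expo i j k) 1 = i" "Poly_Mapping.lookup (expo i j k) 2 = j"
  "Poly_Mapping.lookup (expo i j k) 3 = k"
  by (simp_all add: expo_def lookup_add lookup_single when_def)

lemma monom_eval_expo: "monom_eval (expo i j k) x = (x$1)^i * (x$2)^j * (x$3)^k"
  by (simp add: monom_eval_def prod_3)

text \<open>The degree fixes the third exponent once the first two are known, so the keys embed into
  a triangle of pairs.\<close>

lemma eval_poly_form:
  assumes "is_form d f"
  shows "eval_poly f x = (\<Sum>i\<le>d. \<Sum>j\<le>d-i.
    Poly_Mapping.lookup f (expo i j (d-i-j)) * ((x$1)^i * (x$2)^j * (x$3)^(d-i-j)))"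
proof -
  let ?E = "\<lambda>(i, j). expo i j (d - i - j)"
  let ?T = "Sigma {..d} (\<lambda>i. {..d-i})"
  have sub: "Poly_Mapping.keys f \<subseteq> ?E ` ?T"
  proof
    fix m assume "m \<in> Poly_Mapping.keys f"
    then have s: "Poly_Mapping.lookup m 1 + Poly_Mapping.lookup m 2 + Poly_Mapping.lookup m 3 = d"
      using assms by (auto simp: is_form_def sum_3)
    have "\<forall>l. Poly_Mapping.lookup m l = Poly_Mapping.lookup
       (expo (Poly_Mapping.lookup m 1) (Poly_Mapping.lookup m 2) (Poly_Mapping.lookup m 3)) l"
      by (simp add: forall_3)
    then have "m = expo (Poly_Mapping.lookup m 1) (Poly_Mapping.lookup m 2) (Poly_Mapping.lookup m 3)"
      by (intro poly_mapping_eqI) blast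
    moreover have "Poly_Mapping.lookup m 3 = d - Poly_Mapping.lookup m 1 - Poly_Mapping.lookup m 2"
      using s by linarith
    ultimately have "m = ?E (Poly_Mapping.lookup m 1, Poly_Mapping.lookup m 2)" by simp
    moreover have "(Poly_Mapping.lookup m 1, Poly_Mapping.lookup m 2) \<in> ?T" using s by simp
    ultimately show "m \<in> ?E ` ?T" by (rule image_eqI)
  qed
  have inj: "inj_on ?E ?T"
    by (rule inj_onI) (metis (mono_tags, lifting) case_prod_conv lookup_expo(1,2) prod.collapse)
  have "eval_poly f x = (\<Sum>m\<in>?E ` ?T. Poly_Mapping.lookup f m * monom_eval m x)"
    using eval_poly_superset[OF _ sub] by simp
  also have "\<dots> = (\<Sum>(i, j)\<in>?T. Poly_Mapping.lookup f (expo i j (d-i-j))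
      * ((x$1)^i * (x$2)^j * (x$3)^(d-i-j)))"
    by (subst sum.reindex[OF inj]) (simp only: o_def case_prod_unfold monom_eval_expo)
  also have "\<dots> = (\<Sum>i\<le>d. \<Sum>j\<le>d-i.
      Poly_Mapping.lookup f (expo i j (d-i-j)) * ((x$1)^i * (x$2)^j * (x$3)^(d-i-j)))"
    by (rule sum.Sigma[symmetric]) auto
  finally show ?thesis .
qed

section \<open>Non-negative symmetric quartics on the orthant\<close>

text \<open>Beyond some \<open>b\<close> all values exceed \<open>F a\<close>, so a minimum over the
  compact interval up to \<open>max a b\<close> is global.\<close>

lemma continuous_attains_inf_atLeast:
  fixes F :: "real \<Rightarrow> real"
  assumes "continuous_on {a..} F" "filterlim F at_top at_top"
  obtains t where "t \<ge> a" "\<And>s. s \<ge> a \<Longrightarrow> F t \<le> F s"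
proof -
  have "eventually (\<lambda>t. F a < F t) at_top"
    using assms(2) by (simp add: filterlim_at_top_dense)
  then obtain b where b: "\<And>t. t > b \<Longrightarrow> F a < F t"
    by (auto simp: eventually_at_top_dense)
  have "\<exists>t\<in>{a..max a b}. \<forall>s\<in>{a..max a b}. F t \<le> F s"
    by (rule continuous_attains_inf) (auto intro: continuous_on_subset[OF assms(1)])
  then obtain t where t: "t \<ge> a" "\<And>s. a \<le> s \<Longrightarrow> s \<le> max a b \<Longrightarrow> F t \<le> F s" by auto
  have "F t \<le> F s" if "s \<ge> a" for s
    using t(2)[of a] t(2)[of s] b[of s] that by (cases "s \<le> b") auto
  then show ?thesis using t(1) that by blast
qed

text \<open>The multiple \<open>\<epsilon>\<close> is the minimum of \<open>h(t) / (t (t + 2))\<close> over \<open>t > 0\<close>. If \<open>h(0) = 0\<close>, the quotient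
  extends continuously to \<open>t = 0\<close>, and a minimum there still gives a double zero.\<close>

lemma quartic_tangent:
  fixes A B C D E :: real
  assumes h_eq: "\<And>t. h t = A*t^4 + B*t^3 + C*t^2 + D*t + E"
    and nn: "\<And>t. t \<ge> 0 \<Longrightarrow> h t \<ge> 0" and lead: "A > 0 \<or> A = 0 \<and> B > 0"
  obtains \<epsilon> s where "\<epsilon> \<ge> 0" "s \<ge> 0" "\<And>t. t \<ge> 0 \<Longrightarrow> \<epsilon> * (t * (t + 2)) \<le> h t"
    "h s = \<epsilon> * (s * (s + 2))" "4*A * s^3 + 3*B * s^2 + 2*C * s + D = \<epsilon> * (2 * s + 2)"
proof -
  have deriv_zero: "4*A * s^3 + 3*B * s^2 + 2*C * s + D = \<epsilon> * (2 * s + 2)"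
    if "s > 0" and le: "\<And>t. t \<ge> 0 \<Longrightarrow> \<epsilon> * (t * (t + 2)) \<le> h t" and eq: "h s = \<epsilon> * (s * (s + 2))" for s \<epsilon>
  proof -
    have "((\<lambda>t. h t - \<epsilon> * (t * (t + 2))) has_real_derivative
        (4*A * s^3 + 3*B * s^2 + 2*C * s + D - \<epsilon> * (2 * s + 2))) (at s)"
      unfolding h_eq by (auto intro!: derivative_eq_intros simp: algebra_simps)
    \<comment> \<open>The radius \<open>s\<close> keeps the neighbourhood inside
      \<open>t > 0\<close>, where the inequality is available.\<close>
    then have "4*A * s^3 + 3*B * s^2 + 2*C * s + D - \<epsilon> * (2 * s + 2) = 0"
      by (rule DERIV_local_min[where d = s]) (use le eq \<open>s > 0\<close> in \<open>auto simp: abs_less_iff\<close>)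
    then show ?thesis by simp
  qed
  show ?thesis
  proof (cases "E = 0")
    case True
    define k where "k = (\<lambda>t. A*t^3 + B*t^2 + C*t + D)"
    have hk: "h t = t * k t" for t
      by (simp add: h_eq k_def True algebra_simps eval_nat_numeral)
    define F where "F = (\<lambda>t. k t / (t + 2))"
    have "filterlim F at_top at_top"
      unfolding F_def k_def using lead by (elim disjE conjE; simp; real_asymp)
    moreover have "continuous_on {0..} F"
      unfolding F_def k_def by (intro continuous_intros) auto
    ultimately obtain s where s: "s \<ge> 0" "\<And>t. t \<ge> 0 \<Longrightarrow> F s \<le> F t"
      using continuous_attains_inf_atLeast by blast
    have le: "F s * (t * (t + 2)) \<le> h t" if "t \<ge> 0" for t
    proof -
      have "F s * (t + 2) \<le> k t" using s(2)[OF that] that by (simp add: F_def[THEN fun_cong, of t] field_simps)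
      from mult_left_mono[OF this that] show ?thesis by (simp add: hk algebra_simps)
    qed
    have ks: "k s = F s * (s + 2)" using s(1) by (simp add: F_def)
    have eq: "h s = F s * (s * (s + 2))" by (simp add: hk ks)
    have "F s \<ge> 0"
    proof (cases "s = 0")
      case True
      \<comment> \<open>From \<open>h t = t * k t\<close> the sign of \<open>k\<close> is known only
        for \<open>t > 0\<close>; the limit carries it to 0.\<close>
      have "(k \<longlongrightarrow> k 0) (at_right 0)" unfolding k_def by (intro tendsto_intros)
      moreover have "\<forall>\<^sub>F t in at_right 0. 0 \<le> k t"
        using nn[OF less_imp_le] by (auto simp: hk eventually_at_filter zero_le_mult_iff
            intro!: always_eventually)
      ultimately have "0 \<le> k 0" by (rule tendsto_lowerbound) simp
      then show ?thesis using ks True by simp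
    next
      case False
      then have "0 < s * (s + 2)" using s(1) by simp
      then show ?thesis using nn[OF s(1)] unfolding eq by (simp only: zero_le_mult_iff) linarith
    qed
    \<comment> \<open>At \<open>s = 0\<close> this reads \<open>D = 2 * F 0\<close>, which is the
      value of \<open>k\<close> at 0; elsewhere it is the condition at an interior minimum.\<close>
    moreover have "4*A * s^3 + 3*B * s^2 + 2*C * s + D = F s * (2 * s + 2)"
    proof (cases "s = 0")
      case True
      then show ?thesis using ks by (simp add: k_def)
    next
      case False
      then show ?thesis using deriv_zero[OF _ le eq] s(1) by simp
    qed
    ultimately show ?thesis using that s(1) le eq by blast
  next
    case False
    then have "E > 0" using nn[of 0] by (simp add: h_eq)
    define F where "F = (\<lambda>t. h t / (t * (t + 2)))"
    \<comment> \<open>Since \<open>h 0 > 0\<close>, the quotient \<open>F\<close> exceeds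
      \<open>F 1\<close> near 0. Hence its minimum over \<open>{a..}\<close>, an interval containing
      1, is its minimum over all \<open>t > 0\<close>.\<close>
    have "((\<lambda>t. h t - F 1 * (t * (t + 2))) \<longlongrightarrow> h 0 - F 1 * (0 * (0 + 2))) (at 0)"
      unfolding h_eq by (intro tendsto_intros)
    then have "\<forall>\<^sub>F t in at 0. 0 < h t - F 1 * (t * (t + 2))"
      using \<open>E > 0\<close> by (intro order_tendstoD(1)) (auto simp: h_eq)
    then obtain d where d: "d > 0" "\<And>t. t \<noteq> 0 \<Longrightarrow> \<bar>t\<bar> < d \<Longrightarrow> F 1 * (t * (t + 2)) < h t"
      by (auto simp: eventually_at dist_real_def)
    define a where "a = min d 1 / 2"
    have a: "a > 0" "a < d" "a \<le> 1" using d(1) by (auto simp: a_def min_def)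
    have "filterlim F at_top at_top"
      unfolding F_def h_eq using lead by (elim disjE conjE; simp; real_asymp)
    moreover have "continuous_on {a..} F"
      unfolding F_def h_eq using a by (intro continuous_intros) auto
    ultimately obtain s where s: "s \<ge> a" "\<And>t. t \<ge> a \<Longrightarrow> F s \<le> F t"
      using continuous_attains_inf_atLeast by blast
    have "s > 0" using s a by simp
    have eq: "h s = F s * (s * (s + 2))" using \<open>s > 0\<close> by (simp add: F_def)
    have "F s \<ge> 0" using nn[of s] \<open>s > 0\<close> by (simp add: F_def)
    have le: "F s * (t * (t + 2)) \<le> h t" if t0: "t \<ge> 0" for t
    proof -
      consider "t = 0" | "0 < t" "t < a" | "t \<ge> a" using t0 by linarith
      then show ?thesis
      proof cases
        case 1
        then show ?thesis using nn[of 0] by simp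
      next
        case 2
        have "F s * (t * (t + 2)) \<le> F 1 * (t * (t + 2))"
          using 2 s(2)[of 1] a by (intro mult_right_mono) auto
        also have "\<dots> < h t" using 2 a d(2)[of t] by simp
        finally show ?thesis by simp
      next
        case 3
        then show ?thesis using s(2)[of t] a by (simp add: F_def[THEN fun_cong, of t] pos_le_divide_eq)
      qed
    qed
    show ?thesis using that[OF \<open>F s \<ge> 0\<close> _ le eq deriv_zero[OF \<open>s > 0\<close> le eq]] \<open>s > 0\<close> by simp
  qed
qed

section \<open>Quadratics non-negative on a half-line\<close>

lemma nonneg_at_zero:
  fixes b c d :: real
  assumes "\<And>t. 0 < t \<Longrightarrow> t < 1 \<Longrightarrow> 0 \<le> b + c * t + d * t\<^sup>2"
  shows "0 \<le> b"
proof -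
  have "((\<lambda>t. b + c * t + d * t\<^sup>2) \<longlongrightarrow> b + c * 0 + d * 0\<^sup>2) (at_right 0)"
    by (intro tendsto_intros)
  moreover have "\<forall>\<^sub>F t in at_right 0. 0 \<le> b + c * t + d * t\<^sup>2"
    using assms by (auto simp: eventually_at_right[of 0 1] intro!: exI[of _ 1])
  ultimately have "0 \<le> b + c * 0 + d * 0\<^sup>2" by (rule tendsto_lowerbound) simp
  then show ?thesis by simp
qed

text \<open>Substituting \<open>1/t\<close> swaps \<open>p\<close> and \<open>r\<close>, so both
  signs are limits at 0. For positive \<open>p\<close> and \<open>r\<close> the bound on
  \<open>q\<close> is read off at \<open>t = sqrt r / sqrt p\<close>, where \<open>p*t + r/t\<close>
  is smallest. If one of them vanishes, a factor \<open>t\<close> splits off, after substituting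
  \<open>1/t\<close> when \<open>p = 0\<close>, and the remaining linear function at 0 gives
  \<open>q\<close>.\<close>

lemma quadratic_nonneg_atLeast:
  fixes p q r :: real
  assumes "\<And>t. t > 0 \<Longrightarrow> 0 \<le> p * t\<^sup>2 + q * t + r"
  shows "0 \<le> p" "0 \<le> r" "0 \<le> q + 2 * sqrt p * sqrt r"
proof -
  have scaled: "0 \<le> p + q * t + r * t\<^sup>2" if "t > 0" for t
    using assms[of "1/t"] that by (simp add: field_simps power2_eq_square)
  show p: "0 \<le> p" by (rule nonneg_at_zero[of p q r]) (use scaled in simp)
  show r: "0 \<le> r" by (rule nonneg_at_zero[of _ q p]) (use assms in \<open>simp add: algebra_simps\<close>)
  consider "p = 0" | "r = 0" | "p > 0" "r > 0" using p r by linarith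
  then show "0 \<le> q + 2 * sqrt p * sqrt r"
  proof cases
    case 1
    have "0 \<le> q + r * t + 0 * t\<^sup>2" if "t > 0" for t
      using scaled[OF that] that 1
      by (simp add: power2_eq_square distrib_right[symmetric] mult.assoc[symmetric] zero_le_mult_iff)
    then have "0 \<le> q" using nonneg_at_zero[of q r 0] by blast
    then show ?thesis using 1 by simp
  next
    case 2
    have "0 \<le> q + p * t + 0 * t\<^sup>2" if "t > 0" for t
      using assms[OF that] that 2
      by (simp add: power2_eq_square distrib_right[symmetric] mult.assoc[symmetric] zero_le_mult_iff add.commute)
    then have "0 \<le> q" using nonneg_at_zero[of q p 0] by blast
    then show ?thesis using 2 by simp
  next
    case 3
    define x y where "x = sqrt p" and "y = sqrt r"
    have xy: "x > 0" "y > 0" "p = x\<^sup>2" "r = y\<^sup>2" using 3 by (auto simp: x_def y_def)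
    have "0 \<le> p * (y/x)\<^sup>2 + q * (y/x) + r" using assms[of "y/x"] xy by simp
    also have "\<dots> = (y/x) * (q + 2 * x * y)"
      using xy by (simp add: field_simps power2_eq_square)
    finally have "0 \<le> q + 2 * x * y" using xy by (simp add: zero_le_mult_iff zero_le_divide_iff)
    then show ?thesis by (simp add: x_def y_def)
  qed
qed

section \<open>Certificates for symmetric quartics\<close>

definition symm_quartic :: "real \<Rightarrow> real \<Rightarrow> real \<Rightarrow> real \<Rightarrow> real \<Rightarrow> real \<Rightarrow> real \<Rightarrow> real" where
  "symm_quartic \<alpha> \<beta> \<gamma> \<delta> a b c = \<alpha> * (a+b+c)^4 + \<beta> * ((a+b+c)\<^sup>2 * (a*b+b*c+c*a))
     + \<gamma> * (a*b+b*c+c*a)\<^sup>2 + \<delta> * ((a+b+c) * (a*b*c))"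

text \<open>The value of \<open>symm_quartic\<close> at (1, 1, t), where the elementary symmetric
  functions are \<open>t+2\<close>, \<open>1+2*t\<close> and \<open>t\<close>.\<close>

definition diag_val :: "real \<Rightarrow> real \<Rightarrow> real \<Rightarrow> real \<Rightarrow> real \<Rightarrow> real" where
  "diag_val \<alpha> \<beta> \<gamma> \<delta> t = \<alpha> * (t+2)^4 + \<beta> * ((t+2)\<^sup>2 * (1 + 2*t)) + \<gamma> * (1 + 2*t)\<^sup>2 + \<delta> * (t * (t+2))"

text \<open>The coefficients of the right-hand side of \<open>certified_sos\<close> in the basis
  \<open>s\<^sub>1\<^sup>4, s\<^sub>1\<^sup>2 s\<^sub>2, s\<^sub>2\<^sup>2, s\<^sub>1 s\<^sub>3\<close>.\<close>

definition certified :: "real \<Rightarrow> real \<Rightarrow> real \<Rightarrow> real \<Rightarrow> bool" where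
  "certified \<alpha> \<beta> \<gamma> \<delta> \<longleftrightarrow> (\<exists>\<epsilon> \<kappa> P Q L M. 0 \<le> \<epsilon> \<and> 0 \<le> \<kappa> \<and>
     (\<alpha> = 2 * P\<^sup>2 + L\<^sup>2 \<and> \<beta> = \<kappa> + 2*P*Q - 8 * P\<^sup>2 + 2*L*M \<and>
      \<gamma> = 2 * (P - Q)\<^sup>2 - 4*\<kappa> + M\<^sup>2 \<and> \<delta> = \<epsilon> + 3*\<kappa> + 12 * P\<^sup>2 - 6*P*Q - 6 * Q\<^sup>2))"

text \<open>Every term on the right becomes a sum of squares of forms once \<open>a\<close>,
  \<open>b\<close>, \<open>c\<close> are squares of variables.\<close>

lemma certified_sos:
  assumes "certified \<alpha> \<beta> \<gamma> \<delta>"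
  shows "\<exists>\<epsilon>\<ge>0. \<exists>\<kappa>\<ge>0. \<exists>P Q L M. \<forall>a b c. symm_quartic \<alpha> \<beta> \<gamma> \<delta> a b c
      = \<epsilon> * ((a+b+c) * (a*b*c)) + \<kappa> * (a*b*(a-b)\<^sup>2 + b*c*(b-c)\<^sup>2 + c*a*(c-a)\<^sup>2)
        + ((a-b) * (P*(a+b) + Q*c))\<^sup>2 + ((b-c) * (P*(b+c) + Q*a))\<^sup>2 + ((c-a) * (P*(c+a) + Q*b))\<^sup>2
        + (L * (a+b+c)\<^sup>2 + M * (a*b+b*c+c*a))\<^sup>2"
proof -
  obtain \<epsilon> \<kappa> P Q L M where *: "0 \<le> \<epsilon>" "0 \<le> \<kappa>"
     "\<alpha> = 2 * P\<^sup>2 + L\<^sup>2" "\<beta> = \<kappa> + 2*P*Q - 8 * P\<^sup>2 + 2*L*M"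
      "\<gamma> = 2 * (P - Q)\<^sup>2 - 4*\<kappa> + M\<^sup>2" "\<delta> = \<epsilon> + 3*\<kappa> + 12 * P\<^sup>2 - 6*P*Q - 6 * Q\<^sup>2"
    using assms unfolding certified_def by blast
  have "symm_quartic \<alpha> \<beta> \<gamma> \<delta> a b c
      = \<epsilon> * ((a+b+c) * (a*b*c)) + \<kappa> * (a*b*(a-b)\<^sup>2 + b*c*(b-c)\<^sup>2 + c*a*(c-a)\<^sup>2)
        + ((a-b) * (P*(a+b) + Q*c))\<^sup>2 + ((b-c) * (P*(b+c) + Q*a))\<^sup>2 + ((c-a) * (P*(c+a) + Q*b))\<^sup>2
        + (L * (a+b+c)\<^sup>2 + M * (a*b+b*c+c*a))\<^sup>2" for a b c
    unfolding symm_quartic_def *(3-) by algebra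
  then show ?thesis using *(1,2) by blast
qed

lemma certified_add:
  "certified \<alpha> \<beta> \<gamma> (\<delta> - \<epsilon>) \<Longrightarrow> 0 \<le> \<epsilon> \<Longrightarrow> certified \<alpha> \<beta> \<gamma> \<delta>"
  unfolding certified_def
  by (elim exE conjE, rename_tac e \<kappa> P Q L M, rule_tac x = "e + \<epsilon>" in exI) (smt (verit))

text \<open>A zero of a symmetric form at (1, 1, 1) is automatically double: by symmetry the
  gradient is a multiple of (1, 1, 1), and by Euler's identity it vanishes. So a factor
  \<open>(t-1)\<^sup>2\<close> splits off without a derivative condition.\<close>

lemma certified_if_zero_at_centre:
  assumes nn: "\<And>t. t \<ge> 0 \<Longrightarrow> diag_val \<alpha> \<beta> \<gamma> \<delta> t \<ge> 0" and zero: "diag_val \<alpha> \<beta> \<gamma> \<delta> 1 = 0"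
  shows "certified \<alpha> \<beta> \<gamma> \<delta>"
proof -
  define q r where "q = 10*\<alpha> + 2*\<beta>" and "r = 16*\<alpha> + 4*\<beta> + \<gamma>"
  have \<delta>: "\<delta> = - 27*\<alpha> - 9*\<beta> - 3*\<gamma>" using zero by (simp add: diag_val_def)
  have factor: "diag_val \<alpha> \<beta> \<gamma> \<delta> t = (t - 1)\<^sup>2 * (\<alpha> * t\<^sup>2 + q*t + r)" for t
    unfolding diag_val_def q_def r_def \<delta> by algebra
  have off: "0 \<le> \<alpha> * t\<^sup>2 + q*t + r" if "t \<ge> 0" "t \<noteq> 1" for t
    using nn[OF that(1)] that(2) by (simp add: factor zero_le_mult_iff)
  have quad: "0 \<le> \<alpha> * t\<^sup>2 + q*t + r" if "t \<ge> 0" for t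
  proof (cases "t = 1")
    case True
    have "((\<lambda>t. \<alpha> * t\<^sup>2 + q*t + r) \<longlongrightarrow> \<alpha> * 1\<^sup>2 + q*1 + r) (at 1)" by (intro tendsto_intros)
    moreover have "\<forall>\<^sub>F t in at 1. 0 \<le> \<alpha> * t\<^sup>2 + q*t + r"
      using off by (auto simp: eventually_at dist_real_def intro!: exI[of _ 1])
    ultimately have "0 \<le> \<alpha> * 1\<^sup>2 + q*1 + r" by (rule tendsto_lowerbound) simp
    then show ?thesis using True by simp
  qed (use off that in blast)
  note nonneg = quadratic_nonneg_atLeast[of \<alpha> q r, OF quad[OF less_imp_le]]
  \<comment> \<open>The quadratic factor becomes
    \<open>2 * (P*t - R)\<^sup>2 + 2*\<kappa>*t\<close>. The certificate at (1, 1, t) with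
    \<open>Q = - P - R\<close> and \<open>L = M = 0\<close> is \<open>(t-1)\<^sup>2\<close> times
    this expression, which explains the choice of \<open>Q\<close>.\<close>
  define P R where "P = sqrt (\<alpha> / 2)" and "R = sqrt (r / 2)"
  have PR: "\<alpha> = 2 * P\<^sup>2" "r = 2 * R\<^sup>2" "2 * sqrt \<alpha> * sqrt r = 4 * P * R"
    using nonneg(1,2) by (simp_all add: P_def R_def real_sqrt_divide power_divide)
  define \<kappa> where "\<kappa> = q / 2 + 2 * P * R"
  have "0 \<le> \<kappa>" using nonneg(3) PR(3) by (simp add: \<kappa>_def)
  have q: "q = 2 * \<kappa> - 4 * P * R" by (simp add: \<kappa>_def)
  have \<beta>: "\<beta> = \<kappa> + 2*P*(- P - R) - 8 * P\<^sup>2 + 2*0*0"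
    using q PR(1) unfolding q_def by algebra
  have \<gamma>: "\<gamma> = 2 * (P - (- P - R))\<^sup>2 - 4*\<kappa> + 0\<^sup>2"
  proof -
    have "\<gamma> = r - 16*\<alpha> - 4*\<beta>" by (simp add: r_def)
    also have "\<dots> = 2 * (P - (- P - R))\<^sup>2 - 4*\<kappa> + 0\<^sup>2"
      unfolding PR(1,2) \<beta> by (simp add: power2_eq_square algebra_simps)
    finally show ?thesis .
  qed
  have \<delta>': "\<delta> = 0 + 3*\<kappa> + 12 * P\<^sup>2 - 6*P*(- P - R) - 6 * (- P - R)\<^sup>2"
    unfolding \<delta> PR(1) \<gamma> \<beta> by (simp add: power2_eq_square algebra_simps)
  have \<alpha>: "\<alpha> = 2 * P\<^sup>2 + 0\<^sup>2" using PR(1) by simp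
  show ?thesis
    unfolding certified_def using \<open>0 \<le> \<kappa>\<close> \<alpha> \<beta> \<gamma> \<delta>' by blast
qed

text \<open>After removing the multiple \<open>k\<close> of \<open>(t-1)\<^sup>2 (t-s)\<^sup>2\<close> that matches \<open>\<delta>\<close>, the rest is a quadratic in
  \<open>u = s\<^sub>2 / s\<^sub>1\<^sup>2\<close> with a double zero at \<open>N / D\<close>. For \<open>s \<le> 4\<close>, the point \<open>t = (4 - s) / N\<close> has the same
  value of \<open>u\<close> as \<open>s\<close> and reveals the sign of \<open>k\<close>; for \<open>s > 4\<close>, the edge \<open>c = 0\<close> of the simplex does.\<close>

lemma certified_if_double_zero:
  assumes "s \<ge> 0" "s \<noteq> 1"
    and nn: "\<And>t. t \<ge> 0 \<Longrightarrow> diag_val \<alpha> \<beta> \<gamma> \<delta> t \<ge> 0"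
    and edge: "\<And>u. 0 \<le> u \<Longrightarrow> u \<le> 1/4 \<Longrightarrow> 0 \<le> \<alpha> + \<beta> * u + \<gamma> * u\<^sup>2"
    and zero: "diag_val \<alpha> \<beta> \<gamma> \<delta> s = 0"
    and deriv: "4*\<alpha>*(s+2)^3 + \<beta>*(2*(s+2)*(1+2 * s) + 2*(s+2)\<^sup>2) + 4*\<gamma>*(1+2 * s) + \<delta>*(2 * s+2) = 0"
  shows "certified \<alpha> \<beta> \<gamma> \<delta>"
proof -
  define N D where "N = 1 + 2 * s" and "D = (s+2)\<^sup>2"
  have pos: "N > 0" "D > 0" using assms(1) by (auto simp: N_def D_def)
  define k where "k = - \<delta> / (3 * (s+2) * (s-1))"
  have \<delta>: "\<delta> = - 3 * k * (s+2) * (s-1)" using assms(1,2) by (simp add: k_def divide_simps)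
  define a b c where "a = \<alpha> - k" and "b = \<beta> + k*(s+5)" and "c = \<gamma> - k * D"
  have abc: "\<alpha> = a + k" "\<beta> = b - k*(s+5)" "\<gamma> = c + k * D" by (simp_all add: a_def b_def c_def)
  have z: "a * D\<^sup>2 + b * D * N + c * N\<^sup>2 = 0"
    using zero unfolding diag_val_def abc \<delta> N_def D_def by algebra
  have d: "4 * a * D * (s+2) + b * (2 * (s+2) * N + 2 * D) + 4 * c * N = 0"
    using deriv unfolding abc \<delta> N_def D_def by algebra
  \<comment> \<open>Eliminating \<open>a\<close> from the value and derivative conditions. The
    factor \<open>1-s\<close> stems from the derivative of
    \<open>u = (1+2*t) / (t+2)\<^sup>2\<close>, which vanishes only at \<open>t = 1\<close> on the
    half-line; for other \<open>s\<close> a double zero in \<open>t\<close> is a double zero in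
    \<open>u\<close>.\<close>
  have "2 * (s+2) * (1-s) * (b * D + 2 * c * N)
      = D * (4 * a * D * (s+2) + b * (2 * (s+2) * N + 2 * D) + 4 * c * N)
        - 4 * (s+2) * (a * D\<^sup>2 + b * D * N + c * N\<^sup>2)"
    unfolding N_def D_def by algebra
  then have "2 * (s+2) * (1-s) * (b * D + 2 * c * N) = 0" using d z by simp
  then have b: "b * D = - 2 * c * N" using assms(1,2) by simp
  have a: "a * D\<^sup>2 = c * N\<^sup>2" using z b by algebra
  define m where "m = c / D\<^sup>2"
  have c': "c = m * D\<^sup>2" using pos by (simp add: m_def)
  have "b * D = (- 2 * m * N * D) * D" using b unfolding c' by algebra
  then have b': "b = - 2 * m * N * D" using pos(2) by (metis less_irrefl mult_right_cancel)
  have a': "a = m * N\<^sup>2" using a pos unfolding c' by simp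
  have val: "diag_val \<alpha> \<beta> \<gamma> \<delta> t = k * ((t-1)\<^sup>2 * (t-s)\<^sup>2) + m * (D * (1+2*t) - N * (t+2)\<^sup>2)\<^sup>2" for t
    unfolding diag_val_def abc \<delta> a' b' c' N_def D_def by algebra
  \<comment> \<open>At \<open>t = 1\<close> the \<open>k\<close> term of \<open>val\<close>
    vanishes, leaving \<open>m\<close> times a nonzero square.\<close>
  have "m \<ge> 0"
  proof -
    have "D * 3 - N * 9 = 3 * (s - 1)\<^sup>2" unfolding N_def D_def by algebra
    then have "D * 3 - N * 9 \<noteq> 0" using assms(2) by simp
    then show ?thesis using nn[of 1] by (simp add: val zero_le_mult_iff)
  qed
  have "k \<ge> 0"
  proof (cases "s \<le> 4")
    case True
    define t where "t = (4 - s) / N"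
    have "N * t = 4 - s" using pos by (simp add: t_def)
    then have t1: "N * (1 - t) = 3 * (s - 1)" and t2: "N * (s - t) = 2 * (s - 1) * (s + 2)"
      unfolding N_def by algebra+
    have t: "t \<ge> 0" "t \<noteq> 1" "t \<noteq> s"
      using True pos t1 t2 assms(1,2) by (auto simp: t_def)
    have "D * (1+2*t) - N * (t+2)\<^sup>2 = 0"
      using pos unfolding t_def N_def D_def by (simp add: field_simps) algebra
    moreover have "0 < (t-1)\<^sup>2 * (t-s)\<^sup>2" using t by simp
    moreover have "0 \<le> k * ((t-1)\<^sup>2 * (t-s)\<^sup>2)"
      using nn[OF t(1)] calculation(1) by (simp add: val)
    ultimately show ?thesis by (simp only: zero_le_mult_iff) linarith
  next
    case False
    \<comment> \<open>This puts the double zero \<open>N / D\<close> in [0, 1/4], the range of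
      \<open>u\<close> on the edge, where the \<open>m\<close> square then vanishes as well.\<close>
    have "D - 4 * N = s * (s - 4)" unfolding N_def D_def by algebra
    then have "4 * N \<le> D" using False by (smt (verit) mult_nonneg_nonneg)
    define w where "w = N / D"
    have w: "D * w = N" "0 \<le> w" "w \<le> 1/4"
      using pos \<open>4 * N \<le> D\<close> by (simp_all add: w_def field_simps)
    have "D * (\<alpha> + \<beta> * w + \<gamma> * w\<^sup>2)
        = k * (D - (s+5) * (D * w) + (D * w)\<^sup>2) + D * m * (N - D * w)\<^sup>2"
      unfolding abc a' b' c' by algebra
    also have "\<dots> = k * (D - (s+5) * N + N\<^sup>2)" by (simp add: w(1))
    also have "D - (s+5) * N + N\<^sup>2 = 3 * (s * (s - 1))" unfolding N_def D_def by algebra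
    finally have "0 \<le> k * (3 * (s * (s - 1)))"
      using edge[OF w(2,3)] pos by (metis less_imp_le mult_nonneg_nonneg)
    moreover have "0 < 3 * (s * (s - 1))" using False by simp
    ultimately show ?thesis by (simp only: zero_le_mult_iff) linarith
  qed
  define P M where "P = sqrt (k / 2)" and "M = sqrt m"
  have k: "k = 2 * P\<^sup>2" and m: "m = M\<^sup>2" using \<open>k \<ge> 0\<close> \<open>m \<ge> 0\<close> by (simp_all add: P_def M_def)
  show ?thesis
    unfolding certified_def
  proof (intro exI conjI)
    show "\<alpha> = 2 * P\<^sup>2 + (- M * N)\<^sup>2" unfolding abc(1) a' k m by algebra
    show "\<beta> = 0 + 2 * P * (- (1 + s) * P) - 8 * P\<^sup>2 + 2 * (- M * N) * (M * D)"
      unfolding abc(2) b' k m by algebra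
    show "\<gamma> = 2 * (P - (- (1 + s) * P))\<^sup>2 - 4 * 0 + (M * D)\<^sup>2"
      unfolding abc(3) c' k m D_def by algebra
    show "\<delta> = 0 + 3 * 0 + 12 * P\<^sup>2 - 6 * P * (- (1 + s) * P) - 6 * (- (1 + s) * P)\<^sup>2"
      unfolding \<delta> k by algebra
  qed simp_all
qed

text \<open>Only two families of points are tested: (1, 1, t), and the edge \<open>c = 0\<close>
  normalized by \<open>a + b = 1\<close>, where \<open>u = a*b\<close>. If \<alpha> and \<beta> both
  vanish, the tangent argument lacks growth at infinity and a certificate is written down
  directly.\<close>

lemma certified_if_nonneg:
  assumes nn: "\<And>t. t \<ge> 0 \<Longrightarrow> diag_val \<alpha> \<beta> \<gamma> \<delta> t \<ge> 0"
    and edge: "\<And>u. 0 \<le> u \<Longrightarrow> u \<le> 1/4 \<Longrightarrow> 0 \<le> \<alpha> + \<beta> * u + \<gamma> * u\<^sup>2"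
  shows "certified \<alpha> \<beta> \<gamma> \<delta>"
proof -
  have "\<alpha> \<ge> 0" using edge[of 0] by simp
  have "\<beta> \<ge> 0" if "\<alpha> = 0"
  proof -
    have "0 \<le> \<beta> + (\<gamma> / 4) * u + 0 * u\<^sup>2" if "0 < u" "u < 1" for u
    proof -
      have "0 \<le> (u / 4) * (\<beta> + (\<gamma> / 4) * u)"
        using edge[of "u / 4"] that \<open>\<alpha> = 0\<close> by (simp add: power2_eq_square algebra_simps)
      then show ?thesis using that by (simp add: zero_le_mult_iff)
    qed
    then show ?thesis by (rule nonneg_at_zero)
  qed
  consider "\<alpha> = 0" "\<beta> = 0" "\<delta> \<ge> 0" | "\<alpha> = 0" "\<beta> = 0" "\<delta> < 0" | "\<alpha> > 0 \<or> \<alpha> = 0 \<and> \<beta> > 0"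
    using \<open>\<alpha> \<ge> 0\<close> \<open>\<alpha> = 0 \<Longrightarrow> \<beta> \<ge> 0\<close> by linarith
  then show ?thesis
  proof cases
    case 1
    have "\<gamma> \<ge> 0" using edge[of "1/4"] 1 by (simp add: zero_le_mult_iff)
    then show ?thesis unfolding certified_def 1
      by (intro exI[of _ \<delta>] exI[of _ 0] exI[of _ "sqrt \<gamma>"]) (use 1 in simp)
  next
    case 2
    \<comment> \<open>The sum of \<open>c\<^sup>2 * (a-b)\<^sup>2\<close> over the three pairs is
      \<open>2 * s\<^sub>2\<^sup>2 - 6 * s\<^sub>1 * s\<^sub>3\<close>. Removing
      \<open>- \<delta> / 6\<close> times it cancels the negative \<delta> and leaves this multiple
      of \<open>s\<^sub>2\<^sup>2\<close>.\<close>
    have "\<gamma> + \<delta> / 3 \<ge> 0" using nn[of 1] 2 by (simp add: diag_val_def)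
    moreover have "(sqrt (- \<delta> / 6))\<^sup>2 = - \<delta> / 6" using 2 by simp
    ultimately show ?thesis unfolding certified_def
      by (intro exI[of _ 0] exI[of _ "sqrt (- \<delta> / 6)"] exI[of _ "sqrt (\<gamma> + \<delta> / 3)"]) (simp add: 2(1,2))
  next
    case 3
    have expand: "diag_val \<alpha> \<beta> \<gamma> \<delta> t = \<alpha> * t^4 + (8*\<alpha> + 2*\<beta>) * t^3 + (24*\<alpha> + 9*\<beta> + 4*\<gamma> + \<delta>) * t^2
        + (32*\<alpha> + 12*\<beta> + 4*\<gamma> + 2*\<delta>) * t + (16*\<alpha> + 4*\<beta> + \<gamma>)" for t
      unfolding diag_val_def by algebra
    obtain \<epsilon> s where *: "\<epsilon> \<ge> 0" "s \<ge> 0" "\<And>t. t \<ge> 0 \<Longrightarrow> \<epsilon> * (t * (t + 2)) \<le> diag_val \<alpha> \<beta> \<gamma> \<delta> t"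
      "diag_val \<alpha> \<beta> \<gamma> \<delta> s = \<epsilon> * (s * (s + 2))"
      "4 * \<alpha> * s^3 + 3 * (8*\<alpha> + 2*\<beta>) * s^2 + 2 * (24*\<alpha> + 9*\<beta> + 4*\<gamma> + \<delta>) * s
        + (32*\<alpha> + 12*\<beta> + 4*\<gamma> + 2*\<delta>) = \<epsilon> * (2 * s + 2)"
      by (rule quartic_tangent[OF expand nn]) (use 3 in auto)
    have shift: "diag_val \<alpha> \<beta> \<gamma> (\<delta> - \<epsilon>) t = diag_val \<alpha> \<beta> \<gamma> \<delta> t - \<epsilon> * (t * (t + 2))" for t
      by (simp add: diag_val_def algebra_simps)
    have nn': "\<And>t. t \<ge> 0 \<Longrightarrow> diag_val \<alpha> \<beta> \<gamma> (\<delta> - \<epsilon>) t \<ge> 0" using *(3) by (simp add: shift)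
    have zero': "diag_val \<alpha> \<beta> \<gamma> (\<delta> - \<epsilon>) s = 0" using *(4) by (simp add: shift)
    have deriv': "4*\<alpha>*(s+2)^3 + \<beta>*(2*(s+2)*(1+2 * s) + 2*(s+2)\<^sup>2) + 4*\<gamma>*(1+2 * s) + (\<delta> - \<epsilon>)*(2 * s+2) = 0"
    proof -
      have "4*\<alpha>*(s+2)^3 + \<beta>*(2*(s+2)*(1+2 * s) + 2*(s+2)\<^sup>2) + 4*\<gamma>*(1+2 * s) + (\<delta> - \<epsilon>)*(2 * s+2)
        = 4 * \<alpha> * s^3 + 3 * (8*\<alpha> + 2*\<beta>) * s^2 + 2 * (24*\<alpha> + 9*\<beta> + 4*\<gamma> + \<delta>) * s
          + (32*\<alpha> + 12*\<beta> + 4*\<gamma> + 2*\<delta>) - \<epsilon> * (2 * s + 2)"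
        by algebra
      then show ?thesis using *(5) by simp
    qed
    have "certified \<alpha> \<beta> \<gamma> (\<delta> - \<epsilon>)"
      using certified_if_zero_at_centre[OF nn'] certified_if_double_zero[OF *(2) _ nn' edge zero' deriv'] zero'
      by (cases "s = 1") auto
    then show ?thesis by (rule certified_add) fact
  qed
qed

section \<open>Invariant octics\<close>

lemma sum_atMost_numeral:
  fixes f :: "nat \<Rightarrow> real"
  shows "sum f {..1} = f 0 + f 1" "sum f {..2} = f 0 + f 1 + f 2" "sum f {..3} = f 0 + f 1 + f 2 + f 3"
    "sum f {..4} = f 0 + f 1 + f 2 + f 3 + f 4" "sum f {..5} = f 0 + f 1 + f 2 + f 3 + f 4 + f 5"
    "sum f {..6} = f 0 + f 1 + f 2 + f 3 + f 4 + f 5 + f 6"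
    "sum f {..7} = f 0 + f 1 + f 2 + f 3 + f 4 + f 5 + f 6 + f 7"
    "sum f {..8} = f 0 + f 1 + f 2 + f 3 + f 4 + f 5 + f 6 + f 7 + f 8"
  by (simp_all add: eval_nat_numeral add_ac)

lemma triangular_sum_4:
  fixes f :: "nat \<Rightarrow> nat \<Rightarrow> real"
  shows "(\<Sum>i\<le>4. \<Sum>j\<le>4-i. f i j) =
    (f 0 0 + f 0 1 + f 0 2 + f 0 3 + f 0 4) + (f 1 0 + f 1 1 + f 1 2 + f 1 3)
    + (f 2 0 + f 2 1 + f 2 2) + (f 3 0 + f 3 1) + f 4 0"
  by (simp add: sum_atMost_numeral)

lemma even_triangular_sum_8:
  fixes f :: "nat \<Rightarrow> nat \<Rightarrow> real"
  shows "(\<Sum>i\<le>8. \<Sum>j\<le>8-i. if even i \<and> even j then f i j else 0) = (\<Sum>i\<le>4. \<Sum>j\<le>4-i. f (2*i) (2*j))"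
  by (simp add: sum_atMost_numeral)

text \<open>The four terms cancel unless the three exponents have equal parity, and an even total
  degree rules out three odd ones.\<close>

lemma sign_average:
  fixes x y z :: real
  assumes "even (i + j + k)"
  shows "x^i * y^j * z^k + (- x)^i * (- y)^j * z^k + (- x)^i * y^j * (- z)^k + x^i * (- y)^j * (- z)^k
    = 4 * (if even i \<and> even j then x^i * y^j * z^k else 0)"
  using assms by (cases "even i"; cases "even j"; cases "even k") simp_all

text \<open>Averaging over the four sign changes acts on each monomial separately, so the odd ones
  drop out without any comparison of coefficients.\<close>

lemma even_octic:
  fixes c :: "nat \<Rightarrow> nat \<Rightarrow> real"
  defines "E \<equiv> \<lambda>x y z. \<Sum>i\<le>8. \<Sum>j\<le>8-i. c i j * (x^i * y^j * z^(8-i-j))"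
  assumes "\<And>x y z. E (- x) (- y) z = E x y z" "\<And>x y z. E (- x) y (- z) = E x y z"
    "\<And>x y z. E x (- y) (- z) = E x y z"
  shows "E x y z = (\<Sum>i\<le>4. \<Sum>j\<le>4-i. c (2*i) (2*j) * ((x\<^sup>2)^i * (y\<^sup>2)^j * (z\<^sup>2)^(4-i-j)))"
proof -
  have "4 * E x y z = E x y z + E (- x) (- y) z + E (- x) y (- z) + E x (- y) (- z)"
    by (simp only: assms(2-4))
  also have "\<dots> = (\<Sum>i\<le>8. \<Sum>j\<le>8-i. c i j * (4 * (if even i \<and> even j then x^i * y^j * z^(8-i-j) else 0)))"
    unfolding E_def sum.distrib[symmetric] distrib_left[symmetric]
    by (intro sum.cong refl arg_cong2[where f = "(*)"] sign_average) auto
  also have "\<dots> = 4 * (\<Sum>i\<le>8. \<Sum>j\<le>8-i. if even i \<and> even j then c i j * (x^i * y^j * z^(8-i-j)) else 0)"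
    unfolding sum_distrib_left by (intro sum.cong refl) simp
  finally have "E x y z = (\<Sum>i\<le>8. \<Sum>j\<le>8-i. if even i \<and> even j then c i j * (x^i * y^j * z^(8-i-j)) else 0)"
    by simp
  also have "\<dots> = (\<Sum>i\<le>4. \<Sum>j\<le>4-i. c (2*i) (2*j) * ((x\<^sup>2)^i * (y\<^sup>2)^j * (z\<^sup>2)^(4-i-j)))"
    unfolding even_triangular_sum_8
    by (intro sum.cong refl) (simp add: power_mult[symmetric] diff_mult_distrib2)
  finally show ?thesis .
qed

lemma symmetric_quartic:
  fixes c :: "nat \<Rightarrow> nat \<Rightarrow> real"
  defines "G \<equiv> \<lambda>x y z. \<Sum>i\<le>4. \<Sum>j\<le>4-i. c i j * (x^i * y^j * z^(4-i-j))"
  assumes "\<And>x y z. 0 \<le> x \<Longrightarrow> 0 \<le> y \<Longrightarrow> 0 \<le> z \<Longrightarrow> G y x z = G x y z"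
    "\<And>x y z. 0 \<le> x \<Longrightarrow> 0 \<le> y \<Longrightarrow> 0 \<le> z \<Longrightarrow> G y z x = G x y z"
  shows "\<exists>\<alpha> \<beta> \<gamma> \<delta>. \<forall>x y z. 0 \<le> x \<and> 0 \<le> y \<and> 0 \<le> z \<longrightarrow> G x y z = symm_quartic \<alpha> \<beta> \<gamma> \<delta> x y z"
proof -
  \<comment> \<open>These are the coefficients, after summing over all six permutations, of the
    orbit sums of \<open>x^4\<close>, \<open>x^3*y\<close>, \<open>x\<^sup>2*y\<^sup>2\<close> and
    \<open>x\<^sup>2*y*z\<close>. Rewriting the orbit sums in elementary symmetric functions gives
    the four arguments of \<open>symm_quartic\<close> below.\<close>
  define p q r s where "p = 2 * (c 4 0 + c 0 4 + c 0 0)" and "q = c 3 1 + c 1 3 + c 3 0 + c 0 3 + c 1 0 + c 0 1"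
    and "r = 2 * (c 2 2 + c 2 0 + c 0 2)" and "s = 2 * (c 2 1 + c 1 2 + c 1 1)"
  have expand: "G x y z = (c 0 0 * z^4 + c 0 1 * (y * z^3) + c 0 2 * (y\<^sup>2 * z\<^sup>2) + c 0 3 * (y^3 * z) + c 0 4 * y^4)
    + (c 1 0 * (x * z^3) + c 1 1 * (x * y * z\<^sup>2) + c 1 2 * (x * y\<^sup>2 * z) + c 1 3 * (x * y^3))
    + (c 2 0 * (x\<^sup>2 * z\<^sup>2) + c 2 1 * (x\<^sup>2 * y * z) + c 2 2 * (x\<^sup>2 * y\<^sup>2))
    + (c 3 0 * (x^3 * z) + c 3 1 * (x^3 * y)) + c 4 0 * x^4" for x y z
    unfolding G_def triangular_sum_4 by simp
  have "G x y z = symm_quartic (p/6) ((q - 4*p)/6) ((r - 2*q + 2*p)/6) ((s + 4*p - q - 2*r)/6) x y z"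
    if "0 \<le> x" "0 \<le> y" "0 \<le> z" for x y z
  proof -
    have "6 * G x y z = G x y z + G y x z + G y z x + G z y x + G z x y + G x z y"
      using assms(2,3)[OF that] assms(2,3)[OF that(2,3,1)] assms(2,3)[OF that(3,1,2)] by linarith
    also have "\<dots> = p * (x+y+z)^4 + (q - 4*p) * ((x+y+z)\<^sup>2 * (x*y+y*z+z*x))
      + (r - 2*q + 2*p) * (x*y+y*z+z*x)\<^sup>2 + (s + 4*p - q - 2*r) * ((x+y+z) * (x*y*z))"
      unfolding expand p_def q_def r_def s_def by algebra
    finally have sum6: "6 * G x y z = \<dots>" .
    have "G x y z = (6 * G x y z) / 6" by simp
    then show ?thesis unfolding sum6 symm_quartic_def by (simp add: add_divide_distrib)
  qed
  then show ?thesis by blast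
qed

lemma sign_change_in_D3: "(\<lambda>x. \<chi> i. (if i = k then 1 else - 1) * x $ i) \<in> D3"
proof -
  have "{i. (if i = k then 1 else - 1) = (- 1 :: real)} = UNIV - {k}" by auto
  then have "even (card {i. (if i = k then 1 else - 1) = (- 1 :: real)})" by simp
  then show ?thesis
    unfolding D3_def mem_Collect_eq
    by (intro exI[of _ id] exI[of _ "\<lambda>i. if i = k then 1 else - 1"]) simp
qed

lemma permutation_in_D3: "bij p \<Longrightarrow> (\<lambda>x. \<chi> i. x $ p i) \<in> D3"
  unfolding D3_def mem_Collect_eq by (intro exI[of _ p] exI[of _ "\<lambda>_. 1"]) simp

text \<open>Sign changes make the octic a quartic \<open>G\<close> in the squares. Permutation
  invariance passes to \<open>G\<close> through square roots, hence only on the orthant.\<close>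

lemma octic_normal_form:
  assumes form: "is_form 8 f" and inv: "D3_invariant f"
  shows "\<exists>\<alpha> \<beta> \<gamma> \<delta>. \<forall>x y z.
    eval_poly f (vector [x, y, z]) = symm_quartic \<alpha> \<beta> \<gamma> \<delta> (x\<^sup>2) (y\<^sup>2) (z\<^sup>2)"
proof -
  let ?E = "\<lambda>x y z. eval_poly f (vector [x, y, z])"
  define c where "c = (\<lambda>i j. Poly_Mapping.lookup f (expo i j (8-i-j)))"
  have E: "?E x y z = (\<Sum>i\<le>8. \<Sum>j\<le>8-i. c i j * (x^i * y^j * z^(8-i-j)))" for x y z
    unfolding c_def eval_poly_form[OF form] by (simp only: vector_3)
  have D3: "?E x y z = eval_poly f (g (vector [x, y, z]))" if "g \<in> D3" for g x y z
    using inv that by (simp add: D3_invariant_def)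
  have sign1: "?E (- x) (- y) z = ?E x y z" for x y z
    unfolding D3[OF sign_change_in_D3[of 3], of x y z]
    by (intro arg_cong[where f = "eval_poly f"]) (simp add: vec_eq_iff forall_3)
  have sign2: "?E (- x) y (- z) = ?E x y z" for x y z
    unfolding D3[OF sign_change_in_D3[of 2], of x y z]
    by (intro arg_cong[where f = "eval_poly f"]) (simp add: vec_eq_iff forall_3)
  have sign3: "?E x (- y) (- z) = ?E x y z" for x y z
    unfolding D3[OF sign_change_in_D3[of 1], of x y z]
    by (intro arg_cong[where f = "eval_poly f"]) (simp add: vec_eq_iff forall_3)
  have swap: "?E y x z = ?E x y z" for x y z
    unfolding D3[OF permutation_in_D3[of "Transposition.transpose 1 2"], OF bij_transpose, of x y z]
    by (intro arg_cong[where f = "eval_poly f"]) (simp add: vec_eq_iff forall_3 Transposition.transpose_def)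
  have rotate: "?E y z x = ?E x y z" for x y z
    unfolding D3[OF permutation_in_D3[of "Transposition.transpose 1 2 \<circ> Transposition.transpose 2 3"], OF bij_comp[OF bij_transpose bij_transpose], of x y z]
    by (intro arg_cong[where f = "eval_poly f"]) (simp add: vec_eq_iff forall_3 Transposition.transpose_def)
  define G where "G = (\<lambda>x y z. \<Sum>i\<le>4. \<Sum>j\<le>4-i. c (2*i) (2*j) * (x^i * y^j * z^(4-i-j)))"
  then have G_eq: "G x y z = (\<Sum>i\<le>4. \<Sum>j\<le>4-i. c (2*i) (2*j) * (x^i * y^j * z^(4-i-j)))" for x y z
    by simp
  have EG: "?E x y z = G (x\<^sup>2) (y\<^sup>2) (z\<^sup>2)" for x y z
    using even_octic[of c x y z, folded E, OF sign1 sign2 sign3] unfolding G_eq .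
  have G: "G a b d = ?E (sqrt a) (sqrt b) (sqrt d)" if "0 \<le> a" "0 \<le> b" "0 \<le> d" for a b d
    using that by (simp add: EG)
  have G_swap: "G b a d = G a b d" if "0 \<le> a" "0 \<le> b" "0 \<le> d" for a b d
    unfolding G[OF that] G[OF that(2,1,3)] by (rule swap)
  have G_rotate: "G b d a = G a b d" if "0 \<le> a" "0 \<le> b" "0 \<le> d" for a b d
    unfolding G[OF that] G[OF that(2,3,1)] by (rule rotate)
  have "\<exists>\<alpha> \<beta> \<gamma> \<delta>. \<forall>x y z. 0 \<le> x \<and> 0 \<le> y \<and> 0 \<le> z \<longrightarrow> G x y z = symm_quartic \<alpha> \<beta> \<gamma> \<delta> x y z"
    by (rule symmetric_quartic[of "\<lambda>i j. c (2*i) (2*j)", folded G_eq])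
      (rule G_swap G_rotate; assumption)+
  then obtain \<alpha> \<beta> \<gamma> \<delta> where
    "\<forall>x y z. 0 \<le> x \<and> 0 \<le> y \<and> 0 \<le> z \<longrightarrow> G x y z = symm_quartic \<alpha> \<beta> \<gamma> \<delta> x y z"
    by blast
  then have "\<forall>x y z. ?E x y z = symm_quartic \<alpha> \<beta> \<gamma> \<delta> (x\<^sup>2) (y\<^sup>2) (z\<^sup>2)"
    by (simp add: EG)
  then show ?thesis by blast
qed

section \<open>From non-negative octics to sums of squares\<close>

lemma certified_if_octic_nonneg:
  assumes nf: "\<And>x y z. eval_poly f (vector [x, y, z]) = symm_quartic \<alpha> \<beta> \<gamma> \<delta> (x\<^sup>2) (y\<^sup>2) (z\<^sup>2)"
    and nn: "\<And>x. 0 \<le> eval_poly f x"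
  shows "certified \<alpha> \<beta> \<gamma> \<delta>"
proof -
  have orthant: "0 \<le> symm_quartic \<alpha> \<beta> \<gamma> \<delta> a b c" if "0 \<le> a" "0 \<le> b" "0 \<le> c" for a b c
    using nn[of "vector [sqrt a, sqrt b, sqrt c]"] that by (simp add: nf)
  show ?thesis
  proof (rule certified_if_nonneg)
    fix t :: real assume "t \<ge> 0"
    have "symm_quartic \<alpha> \<beta> \<gamma> \<delta> 1 1 t = diag_val \<alpha> \<beta> \<gamma> \<delta> t"
      unfolding symm_quartic_def diag_val_def by algebra
    then show "0 \<le> diag_val \<alpha> \<beta> \<gamma> \<delta> t" using orthant[of 1 1 t] \<open>t \<ge> 0\<close> by simp
  next
    fix u :: real assume u: "0 \<le> u" "u \<le> 1/4"
    \<comment> \<open>The numbers \<open>a\<close> and \<open>b\<close> are the roots of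
      \<open>X\<^sup>2 - X + u\<close>, real because \<open>u \<le> 1/4\<close>; they realize
      \<open>u\<close> on the edge \<open>c = 0\<close>.\<close>
    define w where "w = sqrt (1 - 4*u)"
    have w: "w\<^sup>2 = 1 - 4*u" "0 \<le> w" "w \<le> 1" using u by (simp_all add: w_def)
    define a b where "a = (1 + w) / 2" and "b = (1 - w) / 2"
    have ab: "a + b = 1" "a * b = u" "0 \<le> a" "0 \<le> b"
      using w by (simp_all add: a_def b_def field_simps power2_eq_square)
    show "0 \<le> \<alpha> + \<beta> * u + \<gamma> * u\<^sup>2"
      using orthant[of a b 0] ab by (simp add: symm_quartic_def)
  qed
qed

lemma nonneg_octic_sos:
  assumes form: "is_form 8 f" and inv: "D3_invariant f" and nn: "\<And>x. 0 \<le> eval_poly f x"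
  shows "sum_of_squares_of_forms f"
proof -
  obtain \<alpha> \<beta> \<gamma> \<delta> where nf: "\<And>x y z.
    eval_poly f (vector [x, y, z]) = symm_quartic \<alpha> \<beta> \<gamma> \<delta> (x\<^sup>2) (y\<^sup>2) (z\<^sup>2)"
    using octic_normal_form[OF form inv] by blast
  obtain \<epsilon> \<kappa> P Q L M where pos: "0 \<le> \<epsilon>" "0 \<le> \<kappa>" and decomp:
    "\<And>a b c. symm_quartic \<alpha> \<beta> \<gamma> \<delta> a b c
      = \<epsilon> * ((a+b+c) * (a*b*c)) + \<kappa> * (a*b*(a-b)\<^sup>2 + b*c*(b-c)\<^sup>2 + c*a*(c-a)\<^sup>2)
        + ((a-b) * (P*(a+b) + Q*c))\<^sup>2 + ((b-c) * (P*(b+c) + Q*a))\<^sup>2 + ((c-a) * (P*(c+a) + Q*b))\<^sup>2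
        + (L * (a+b+c)\<^sup>2 + M * (a*b+b*c+c*a))\<^sup>2"
    using certified_sos[OF certified_if_octic_nonneg[OF nf nn]] by blast
  define e k where "e = sqrt \<epsilon>" and "k = sqrt \<kappa>"
  have e: "\<epsilon> = e\<^sup>2" and k: "\<kappa> = k\<^sup>2" using pos by (simp_all add: e_def k_def)
  let ?c = const_poly and ?X = "var 1" and ?Y = "var 2" and ?Z = "var 3"
  let ?A = "?X\<^sup>2" and ?B = "?Y\<^sup>2" and ?C = "?Z\<^sup>2"
  \<comment> \<open>With squares substituted, \<open>s\<^sub>1 * s\<^sub>3\<close> is the square of
    \<open>x*y*z\<close> times the sum of three squares, and \<open>a*b*(a-b)\<^sup>2\<close> is the
    square of \<open>x*y*(x\<^sup>2-y\<^sup>2)\<close>.\<close>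
  let ?F = "(?c e * (?X * ?Y * ?Z * ?X))\<^sup>2 + (?c e * (?X * ?Y * ?Z * ?Y))\<^sup>2 + (?c e * (?X * ?Y * ?Z * ?Z))\<^sup>2
    + ((?c k * (?X * ?Y * (?A - ?B)))\<^sup>2 + (?c k * (?Y * ?Z * (?B - ?C)))\<^sup>2
      + (?c k * (?Z * ?X * (?C - ?A)))\<^sup>2)
    + ((?A - ?B) * (?c P * (?A + ?B) + ?c Q * ?C))\<^sup>2 + ((?B - ?C) * (?c P * (?B + ?C) + ?c Q * ?A))\<^sup>2
    + ((?C - ?A) * (?c P * (?C + ?A) + ?c Q * ?B))\<^sup>2
    + (?c L * (?A + ?B + ?C)\<^sup>2 + ?c M * (?A * ?B + ?B * ?C + ?C * ?A))\<^sup>2"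
  have "f = ?F"
  proof (rule eval_poly_inject)
    fix v :: "real ^ 3"
    have "v = vector [v $ 1, v $ 2, v $ 3]" by (simp add: vec_eq_iff forall_3)
    then obtain x y z where v: "v = vector [x, y, z]" by blast
    have \<epsilon>_part: "\<epsilon> * ((x\<^sup>2 + y\<^sup>2 + z\<^sup>2) * (x\<^sup>2 * y\<^sup>2 * z\<^sup>2))
        = (e * (x * y * z * x))\<^sup>2 + (e * (x * y * z * y))\<^sup>2 + (e * (x * y * z * z))\<^sup>2"
      unfolding e by algebra
    have \<kappa>_part: "\<kappa> * (x\<^sup>2 * y\<^sup>2 * (x\<^sup>2 - y\<^sup>2)\<^sup>2 + y\<^sup>2 * z\<^sup>2 * (y\<^sup>2 - z\<^sup>2)\<^sup>2 + z\<^sup>2 * x\<^sup>2 * (z\<^sup>2 - x\<^sup>2)\<^sup>2)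
        = (k * (x * y * (x\<^sup>2 - y\<^sup>2)))\<^sup>2 + (k * (y * z * (y\<^sup>2 - z\<^sup>2)))\<^sup>2 + (k * (z * x * (z\<^sup>2 - x\<^sup>2)))\<^sup>2"
      unfolding k by algebra
    show "eval_poly f v = eval_poly ?F v"
      unfolding v nf decomp \<epsilon>_part \<kappa>_part
      by (simp only: eval_poly_add eval_poly_diff eval_poly_mult eval_poly_power2
          eval_const_poly eval_var vector_3)
  qed
  moreover have "sum_of_squares_of_forms ?F"
    by (intro sum_of_squares_of_forms_add)
      (rule sum_of_squares_of_forms_power2 is_form_mult is_form_power2 is_form_add is_form_diff
        is_form_const_poly is_form_var)+
  ultimately show ?thesis by (simp only:)
qed

theorem theorem4p19: "sos_D3_forms 8 = nonneg_D3_forms 8"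
  by (auto simp: sos_D3_forms_def nonneg_D3_forms_def
      intro: nonneg_octic_sos sum_of_squares_of_forms_nonneg)

end
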